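(* Let $\lambda$ be a nonzero real number. For every integer $n\ge 0$, $$\phi_{n,\lambda}(x)=\sum_{l=0}^{n}\beta_{l,\lambda}S_{2,\lambda}(n,l)+\sum_{k=1}^{n}\Big\{\frac{1}{k!}\sum_{j=0}^{n-1}\sum_{l=0}^{k-1}\binom{n}{j}\binom{k-1}{l}(1)_{n-j,\lambda}(-1)^{k-1-l}\phi_{j,\lambda}(l)\Big\}b_{k,\lambda}(x).$$
   Context: For $\lambda\neq 0$: $(x)_{0,\lambda}=1$ and $(x)_{n,\lambda}=x(x-\lambda)\cdots(x-(n-1)\lambda)$ for $n\ge1$. The degenerate exponential is $e_\lambda^{x}(t)=\sum_{k\ge0}(x)_{k,\lambda}\frac{t^k}{k!}=(1+\lambda t)^{x/\lambda}$, $e_\lambda(t)=e_\lambda^1(t)$, and $\log_\lambda(1+t)=\frac{1}{\lambda}\big((1+t)^\lambda-1\big)$ is the compositional inverse of $e_\lambda(t)$. The degenerate Stirling numbers of the second kind are defined by $\frac{1}{k!}(e_\lambda(t)-1)^k=\sum_{n\ge k}S_{2,\lambda}(n,k)\frac{t^n}{n!}$. The degenerate Bernoulli numbers $\beta_{n,\lambda}$ are defined by $\frac{t}{e_\lambda(t)-1}=\sum_{n\ge0}\beta_{n,\lambda}\frac{t^n}{n!}$. The degenerate Bernoulli polynomials of the second kind are defined by $\frac{t}{\log_\lambda(1+t)}(1+t)^x=\sum_{n\ge0}b_{n,\lambda}(x)\frac{t^n}{n!}$. The fully degenerate Bell polynomials $\phi_{n,\lambda}(x)$ are defined by $e_\lambda^{x}\big(e_\lambda(t)-1\big)=\sum_{n\ge0}\phi_{n,\lambda}(x)\frac{t^n}{n!}$.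 *)

theory Defs
  imports Complex_Main "HOL-Computational_Algebra.Formal_Power_Series"
begin

text \<open>
  All generating functions are formal power series in \<open>t\<close> (that is, \<open>fps_X\<close>) over the reals;
  polynomials in \<open>x\<close> are represented by their values at an arbitrary real \<open>x\<close>.
\<close>

definition degen_ffact :: "real \<Rightarrow> nat \<Rightarrow> real \<Rightarrow> real" where
  "degen_ffact lam n x = (\<Prod>i<n. x - real i * lam)"

definition degen_exp :: "real \<Rightarrow> real \<Rightarrow> real fps" where
  "degen_exp lam x = Abs_fps (\<lambda>k. degen_ffact lam k x / fact k)"

text \<open>\<open>fps_binomial a\<close> is the series \<open>(1 + t)\<close> to the power \<open>a\<close>, so this is the
  degenerate logarithm at \<open>1 + t\<close>.\<close>

definition degen_log1p :: "real \<Rightarrow> real fps" where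
  "degen_log1p lam = fps_const (1 / lam) * (fps_binomial lam - 1)"

definition degen_stirling2 :: "real \<Rightarrow> nat \<Rightarrow> nat \<Rightarrow> real" where
  "degen_stirling2 lam n k =
     fact n * fps_nth (fps_const (1 / fact k) * (degen_exp lam 1 - 1) ^ k) n"

text \<open>In the next two quotients the denominator has zero constant term and linear coefficient 1
  (for \<open>lam \<noteq> 0\<close>), so the division of power series is exact; see
  \<open>degen_bernoulli_gf\<close> and \<open>degen_bernoulli2_gf\<close> below.\<close>

definition degen_bernoulli :: "real \<Rightarrow> nat \<Rightarrow> real" where
  "degen_bernoulli lam n = fact n * fps_nth (fps_X / (degen_exp lam 1 - 1)) n"

definition degen_bernoulli2 :: "real \<Rightarrow> nat \<Rightarrow> real \<Rightarrow> real" where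
  "degen_bernoulli2 lam n x =
     fact n * fps_nth (fps_X / degen_log1p lam * fps_binomial x) n"

definition degen_bell :: "real \<Rightarrow> nat \<Rightarrow> real \<Rightarrow> real" where
  "degen_bell lam n x = fact n * fps_nth (degen_exp lam x oo (degen_exp lam 1 - 1)) n"

lemma fps_X_dvd_of_coeffs:
  fixes f :: "real fps"
  assumes "fps_nth f 0 = 0" "fps_nth f 1 = 1"
  shows "f dvd fps_X"
proof -
  have "f \<noteq> 0" using assms by auto
  moreover have "subdegree f = 1"
    using assms by (intro subdegreeI) auto
  ultimately show ?thesis by (simp add: fps_dvd_iff)
qed

lemma degen_bernoulli_gf:
  "(degen_exp lam 1 - 1) * Abs_fps (\<lambda>n. degen_bernoulli lam n / fact n) = fps_X"
proof -
  have "(degen_exp lam 1 - 1) dvd fps_X"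
    by (rule fps_X_dvd_of_coeffs) (simp_all add: degen_exp_def degen_ffact_def)
  moreover have "Abs_fps (\<lambda>n. degen_bernoulli lam n / fact n) = fps_X / (degen_exp lam 1 - 1)"
    by (rule fps_ext) (simp add: degen_bernoulli_def)
  ultimately show ?thesis by simp
qed

lemma degen_bernoulli2_gf:
  assumes "lam \<noteq> 0"
  shows "degen_log1p lam * Abs_fps (\<lambda>n. degen_bernoulli2 lam n x / fact n)
    = fps_X * fps_binomial x"
proof -
  have "degen_log1p lam dvd fps_X"
    using assms by (intro fps_X_dvd_of_coeffs) (simp_all add: degen_log1p_def)
  moreover have "Abs_fps (\<lambda>n. degen_bernoulli2 lam n x / fact n)
      = fps_X / degen_log1p lam * fps_binomial x"
    by (rule fps_ext) (simp add: degen_bernoulli2_def)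
  ultimately show ?thesis by (simp add: mult.assoc [symmetric])
qed

lemma degen_exp_eq_binomial:
  assumes "lam \<noteq> 0"
  shows "degen_exp lam x = fps_binomial (x / lam) oo (fps_const lam * fps_X)"
proof (rule fps_ext)
  fix n
  have "(\<Prod>i<n. x - real i * lam) = (\<Prod>i<n. lam * (x / lam - real i))"
    using assms by (intro prod.cong) (simp_all add: field_simps)
  also have "\<dots> = lam ^ n * (\<Prod>i<n. x / lam - real i)"
    by (simp add: prod.distrib)
  finally show "fps_nth (degen_exp lam x) n
      = fps_nth (fps_binomial (x / lam) oo (fps_const lam * fps_X)) n"
    by (simp add: degen_exp_def degen_ffact_def fps_compose_linear gbinomial_prod_rev
        atLeast0LessThan)
qed

end

theory Submission
  imports Defs
begin

text \<open>
  Put \<open>u = e\<^sub>\<lambda>(t) - 1\<close> and \<open>h = u(u(t))\<close>. Substituting \<open>u\<close> inverts the degenerate logarithm and turns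
  \<open>(1 + t)\<^sup>x\<close> into \<open>e\<^sub>\<lambda>\<^sup>x(t)\<close>, so substituting \<open>h\<close> into the generating function \<open>B\<close> of the \<open>b\<^sub>k(x)\<close>
  gives \<open>u \<cdot> B(h) = h \<cdot> e\<^sub>\<lambda>\<^sup>x(u)\<close>. Splitting \<open>B = 1 + t C\<close> and using \<open>u = h \<cdot> \<beta>(u)\<close>, where \<open>\<beta>\<close> is the
  generating function of the degenerate Bernoulli numbers, and cancelling \<open>h\<close>, one obtains
  \<open>e\<^sub>\<lambda>\<^sup>x(u) = \<beta>(u) + u \<cdot> C(h)\<close>. The theorem is a comparison of coefficients, with
  \<open>h ^ (k - 1) = (e\<^sub>\<lambda>(u) - 1) ^ (k - 1)\<close> expanded by the binomial theorem.
\<close>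

unbundle fps_syntax

lemma fps_binomial_deriv_mult:
  fixes c :: "'a::field_char_0"
  shows "(1 + fps_X) * fps_deriv (fps_binomial c) = fps_const c * fps_binomial c"
proof -
  have "(1 + fps_X :: 'a fps) dvd fps_const c * fps_binomial c"
    by (rule unit_imp_dvd) simp
  then show ?thesis
    by (simp add: fps_binomial_deriv)
qed

text \<open>Both sides have constant term 1 and solve \<open>(1 + fps_X) * a' = d c a\<close>, which
  has only one such solution.\<close>

lemma fps_binomial_compose:
  fixes c d :: "'a::field_char_0"
  shows "fps_binomial d oo (fps_binomial c - 1) = fps_binomial (d * c)"
proof -
  define v where "v = fps_binomial c - 1"
  define a where "a = fps_binomial d oo v"
  have v0: "v $ 0 = 0"
    by (simp add: v_def)
  have "((1 + fps_X) * fps_deriv (fps_binomial d)) oo v = fps_const d * a"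
    by (simp add: fps_binomial_deriv_mult a_def fps_const_mult_apply_left)
  \<comment> \<open>Here \<open>1 + v\<close> is \<open>fps_binomial c\<close>.\<close>
  then have *: "fps_binomial c * (fps_deriv (fps_binomial d) oo v) = fps_const d * a"
    using v0 by (simp add: fps_compose_mult_distrib fps_compose_add_distrib v_def)
  have "(1 + fps_X) * fps_deriv a
      = (fps_deriv (fps_binomial d) oo v) * ((1 + fps_X) * fps_deriv (fps_binomial c))"
    using v0 by (simp add: a_def fps_compose_deriv) (simp add: v_def mult_ac)
  also have "\<dots> = fps_const c * (fps_binomial c * (fps_deriv (fps_binomial d) oo v))"
    unfolding fps_binomial_deriv_mult by (simp add: mult_ac)
  also have "\<dots> = fps_const (d * c) * a"
    by (simp add: * mult_ac flip: fps_const_mult)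
  finally have ode: "(1 + fps_X) * fps_deriv a = fps_const (d * c) * a" .
  have "(1 + fps_X :: 'a fps) \<noteq> 0"
    by (metis add.right_neutral fps_X_nth fps_add_nth fps_one_nth fps_zero_nth zero_neq_one)
  then have "fps_deriv a = fps_const (d * c) * a / (1 + fps_X)"
    by (simp flip: ode)
  moreover have "a $ 0 = 1"
    by (simp add: a_def)
  ultimately show ?thesis
    using fps_binomial_ODE_unique'[of a "d * c"] by (simp add: a_def v_def)
qed

text \<open>After the scaling of \<open>fps_X\<close> by \<open>lam\<close> is factored out, the
  exponents multiply: \<open>x * (1 / lam)\<close>.\<close>

lemma fps_binomial_compose_degen_exp:
  assumes "lam \<noteq> 0"
  shows "fps_binomial x oo (degen_exp lam 1 - 1) = degen_exp lam x"
proof -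
  have "degen_exp lam 1 - 1 = (fps_binomial (1 / lam) - 1) oo (fps_const lam * fps_X)"
    using assms by (simp add: degen_exp_eq_binomial fps_compose_sub_distrib)
  then have "fps_binomial x oo (degen_exp lam 1 - 1)
      = fps_binomial x oo (fps_binomial (1 / lam) - 1) oo (fps_const lam * fps_X)"
    by (simp add: fps_compose_assoc)
  then show ?thesis
    using assms by (simp add: fps_binomial_compose degen_exp_eq_binomial)
qed

text \<open>The substitution turns \<open>fps_binomial lam\<close> into
  \<open>degen_exp lam lam\<close>, which is just \<open>1 + lam t\<close>.\<close>

lemma degen_log1p_compose_degen_exp:
  assumes "lam \<noteq> 0"
  shows "degen_log1p lam oo (degen_exp lam 1 - 1) = fps_X"
proof -
  have "degen_log1p lam oo (degen_exp lam 1 - 1) = fps_const (1 / lam) * (degen_exp lam lam - 1)"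
    using assms
    by (simp add: degen_log1p_def fps_binomial_compose_degen_exp fps_compose_sub_distrib
        flip: fps_const_mult_apply_left)
  also have "degen_exp lam lam = 1 + fps_const lam * fps_X"
    using assms by (simp add: degen_exp_eq_binomial fps_binomial_1 fps_compose_add_distrib)
  finally show ?thesis
    using assms by (simp flip: mult.assoc)
qed

lemma degen_exp_power:
  assumes "lam \<noteq> 0"
  shows "degen_exp lam 1 ^ l = degen_exp lam (real l)"
  using assms by (simp add: degen_exp_eq_binomial fps_compose_power fps_binomial_power)

text \<open>Since \<open>u * h ^ k\<close> vanishes below order \<open>k + 1\<close>, only
  \<open>k < n\<close> contribute; the index is then shifted by one.\<close>

lemma fps_mult_compose_nth:
  fixes u c h :: "'a::idom fps"
  assumes "u $ 0 = 0" "h $ 0 = 0"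
  shows "(u * (c oo h)) $ n = (\<Sum>k=1..n. c $ (k - 1) * (u * h ^ (k - 1)) $ n)"
proof -
  have h: "h ^ k $ i = 0" if "i < k" for i k
    using assms(2) that by (simp add: startsby_zero_power_prefix)
  \<comment> \<open>The inner sum, naturally ending at \<open>n - i\<close>, is padded with zeros up
    to \<open>n\<close> so that the two sums can be swapped.\<close>
  have "(u * (c oo h)) $ n = (\<Sum>i=0..n. u $ i * (\<Sum>k=0..n. c $ k * h ^ k $ (n - i)))"
    unfolding fps_mult_nth fps_compose_nth
    by (intro sum.cong refl arg_cong2[where f = "(*)"] sum.mono_neutral_left) (auto simp: h)
  also have "\<dots> = (\<Sum>i=0..n. \<Sum>k=0..n. c $ k * (u $ i * h ^ k $ (n - i)))"
    by (simp add: sum_distrib_left mult_ac)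
  also have "\<dots> = (\<Sum>k=0..n. c $ k * (u * h ^ k) $ n)"
    by (subst sum.swap) (simp add: sum_distrib_left fps_mult_nth)
  also have "\<dots> = (\<Sum>k<n. c $ k * (u * h ^ k) $ n)"
  proof -
    have "(u * h ^ n) $ n = 0"
      unfolding fps_mult_nth using assms(1)
      by (intro sum.neutral ballI) (metis atLeastAtMost_iff diff_less h le_zero_eq mult_eq_0_iff
          less_le_trans neq0_conv)
    then show ?thesis
      by (simp add: atLeast0AtMost flip: lessThan_Suc_atMost)
  qed
  also have "\<dots> = (\<Sum>k=1..n. c $ (k - 1) * (u * h ^ (k - 1)) $ n)"
    by (rule sum.reindex_bij_witness[of _ "\<lambda>k. k - 1" Suc]) auto
  finally show ?thesis .
qed

lemma degen_bell_gf_split: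
  fixes lam x :: real
  defines "u \<equiv> degen_exp lam 1 - 1"
  defines "B \<equiv> Abs_fps (\<lambda>n. degen_bernoulli2 lam n x / fact n)"
  defines "\<beta> \<equiv> Abs_fps (\<lambda>n. degen_bernoulli lam n / fact n)"
  assumes lam: "lam \<noteq> 0"
  shows "degen_exp lam x oo u = (\<beta> oo u) + u * (fps_shift 1 B oo (u oo u))"
proof -
  define h where "h = u oo u"
  have u0: "u $ 0 = 0" and u1: "u $ 1 = 1"
    by (simp_all add: u_def degen_exp_def degen_ffact_def)
  have h0: "h $ 0 = 0"
    by (simp add: h_def u0)
  have h: "f oo h = (f oo u) oo u" for f
    by (simp add: h_def fps_compose_assoc u0)
  \<comment> \<open>This licenses the final cancellation of \<open>h\<close>.\<close>
  have "h \<noteq> 0"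
    using u0 u1 by (auto simp: h_def fps_compose_eq_0_iff)
  have log_h: "degen_log1p lam oo h = u"
    unfolding h using degen_log1p_compose_degen_exp[OF lam] u0 by (simp flip: u_def)
  have binomial_h: "fps_binomial x oo h = degen_exp lam x oo u"
    unfolding h by (simp add: u_def fps_binomial_compose_degen_exp lam)
  have "(degen_log1p lam * B) oo h = (fps_X * fps_binomial x) oo h"
    using degen_bernoulli2_gf[OF lam, of x] by (simp add: B_def)
  then have gf2: "u * (B oo h) = h * (degen_exp lam x oo u)"
    by (simp add: fps_compose_mult_distrib h0 log_h binomial_h)
  have "(u * \<beta>) oo u = fps_X oo u"
    using degen_bernoulli_gf[of lam] by (simp add: u_def \<beta>_def)
  then have gf1: "h * (\<beta> oo u) = u"
    by (simp add: fps_compose_mult_distrib u0 flip: h_def)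
  \<comment> \<open>Linear coefficients are compared, as \<open>degen_log1p lam\<close> starts with
    \<open>fps_X\<close>.\<close>
  have "B $ 0 = 1"
  proof -
    have "(degen_log1p lam * B) $ 1 = (fps_X * fps_binomial x) $ 1"
      using degen_bernoulli2_gf[OF lam, of x] by (simp add: B_def)
    then show ?thesis
      using lam by (simp add: fps_mult_nth degen_log1p_def)
  qed
  then have "B = 1 + fps_X * fps_shift 1 B"
    by (intro fps_ext) auto
  then have "B oo h = 1 + h * (fps_shift 1 B oo h)"
    by (metis fps_X_fps_compose_startby0 fps_compose_1 fps_compose_add_distrib
        fps_compose_mult_distrib h0)
  with gf2 have "h * (degen_exp lam x oo u) = u + h * (u * (fps_shift 1 B oo h))"
    by (simp add: algebra_simps)
  also have "\<dots> = h * ((\<beta> oo u) + u * (fps_shift 1 B oo h))"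
    using gf1 by (simp add: distrib_left)
  finally show ?thesis
    using \<open>h \<noteq> 0\<close> by (simp add: h_def)
qed

text \<open>Expanding \<open>(e - 1) ^ m\<close> with \<open>e = degen_exp lam 1 oo u\<close> gives
  powers \<open>e ^ l = degen_exp lam l oo u\<close>, the generating functions of the Bell values at
  \<open>l\<close>.\<close>

lemma degen_bell_coeff:
  fixes lam :: real and n m :: nat
  defines "u \<equiv> degen_exp lam 1 - 1"
  assumes lam: "lam \<noteq> 0" and "n \<ge> 1"
  shows "fact n * (u * (u oo u) ^ m) $ n =
    (\<Sum>j=0..n-1. \<Sum>l=0..m. real (n choose j) * real (m choose l) * degen_ffact lam (n - j) 1 *
       (-1) ^ (m - l) * degen_bell lam j (real l))"
proof -
  have u0: "u $ 0 = 0"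
    by (simp add: u_def degen_exp_def degen_ffact_def)
  have un: "u $ k = degen_ffact lam k 1 / fact k" if "k > 0" for k
    using that by (simp add: u_def degen_exp_def)
  have "(u oo u) ^ m = ((degen_exp lam 1 oo u) + (- 1)) ^ m"
    by (subst (1) u_def) (simp add: fps_compose_sub_distrib)
  also have "\<dots> = (\<Sum>l\<le>m. of_nat (m choose l) * (degen_exp lam 1 oo u) ^ l * (- 1) ^ (m - l))"
    by (rule binomial_ring)
  also have "\<dots> = (\<Sum>l=0..m. fps_const (real (m choose l) * (-1) ^ (m - l))
      * (degen_exp lam (real l) oo u))"
    using lam u0
    by (intro sum.cong)
       (auto simp: fps_compose_power degen_exp_power fps_of_nat mult_ac
         simp flip: fps_const_mult fps_const_power fps_const_neg fps_const_1_eq_1)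
  finally have pow: "(u oo u) ^ m = \<dots>" .
  have "fact n * (u * (u oo u) ^ m) $ n = fact n * (\<Sum>j=0..n. (u oo u) ^ m $ j * u $ (n - j))"
    by (simp add: mult.commute[of u] fps_mult_nth)
  \<comment> \<open>The term \<open>j = n\<close> carries \<open>u $ 0 = 0\<close>; for the others
    \<open>un\<close> applies.\<close>
  also have "\<dots> = fact n * (\<Sum>j=0..n-1. (u oo u) ^ m $ j * u $ (n - j))"
    using u0 \<open>n \<ge> 1\<close> by (cases n) auto
  also have "\<dots> = (\<Sum>j=0..n-1. \<Sum>l=0..m. fact n * u $ (n - j) * (real (m choose l) *
      (-1) ^ (m - l) * (degen_exp lam (real l) oo u) $ j))"
    by (simp add: pow fps_sum_nth sum_distrib_left sum_distrib_right mult_ac)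
  also have "\<dots> = (\<Sum>j=0..n-1. \<Sum>l=0..m. real (n choose j) * real (m choose l) *
      degen_ffact lam (n - j) 1 * (-1) ^ (m - l) * degen_bell lam j (real l))"
    using \<open>n \<ge> 1\<close>
    by (intro sum.cong refl) (simp add: un degen_bell_def binomial_fact flip: u_def)
  finally show ?thesis .
qed

theorem theorem8:
  fixes lam x :: real and n :: nat
  assumes "lam \<noteq> 0"
  shows "degen_bell lam n x =
    (\<Sum>l=0..n. degen_bernoulli lam l * degen_stirling2 lam n l) +
    (\<Sum>k=1..n.
       (1 / fact k *
        (\<Sum>j=0..n-1. \<Sum>l=0..k-1.
           real (n choose j) * real ((k - 1) choose l) * degen_ffact lam (n - j) 1 *
           (-1) ^ (k - 1 - l) * degen_bell lam j (real l))) *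
       degen_bernoulli2 lam k x)"
proof -
  define u where "u = degen_exp lam 1 - 1"
  define B where "B = Abs_fps (\<lambda>n. degen_bernoulli2 lam n x / fact n)"
  define \<beta> where "\<beta> = Abs_fps (\<lambda>n. degen_bernoulli lam n / fact n)"
  have u0: "u $ 0 = 0"
    by (simp add: u_def degen_exp_def degen_ffact_def)
  have "degen_bell lam n x =
      fact n * (\<beta> oo u) $ n + fact n * (u * (fps_shift 1 B oo (u oo u))) $ n"
    using degen_bell_gf_split[OF assms, of x]
    by (simp add: degen_bell_def u_def B_def \<beta>_def distrib_left)
  also have "fact n * (\<beta> oo u) $ n = (\<Sum>l=0..n. degen_bernoulli lam l * degen_stirling2 lam n l)"
    by (simp add: fps_compose_nth sum_distrib_left degen_stirling2_def \<beta>_def u_def mult_ac)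
  \<comment> \<open>The factor \<open>1 / fact k\<close> comes from
    \<open>fps_shift 1 B $ (k - 1) = B $ k\<close>.\<close>
  also have "fact n * (u * (fps_shift 1 B oo (u oo u))) $ n =
      (\<Sum>k=1..n. (1 / fact k * (fact n * (u * (u oo u) ^ (k - 1)) $ n)) * degen_bernoulli2 lam k x)"
    unfolding sum_distrib_left
    by (subst fps_mult_compose_nth) (auto simp: u0 B_def sum_distrib_left intro!: sum.cong)
  also have "\<dots> = (\<Sum>k=1..n.
       (1 / fact k *
        (\<Sum>j=0..n-1. \<Sum>l=0..k-1.
           real (n choose j) * real ((k - 1) choose l) * degen_ffact lam (n - j) 1 *
           (-1) ^ (k - 1 - l) * degen_bell lam j (real l))) *
       degen_bernoulli2 lam k x)"
    unfolding u_def using assms by (intro sum.cong refl) (simp add: degen_bell_coeff)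
  finally show ?thesis .
qed

end
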